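(* Let $k\geq 2$ and $q\geq 3$ be integers and let $(F^{(k)}_{q,n})_{n\geq 2-k}$ be the sequence of $(q,k)$-generalized Fibonacci numbers. Let $(U_{q,n})_{n\geq1}$ be defined by $U_{q,1}=1$, $U_{q,2}=q$ and $U_{q,n}=(q+1)U_{q,n-1}-(q-1)U_{q,n-2}$ for $n\geq 3$, and let $(V_{q,n})_{n\geq 1}$ be defined by $V_{q,1}=1$, $V_{q,2}=q+1$ and $V_{q,n}=(q+1)V_{q,n-1}-(q-1)V_{q,n-2}$ for $n\geq 3$. Then \[ F^{(k)}_{q,n}=U_{q,n}\quad\text{for all } 1\leq n\leq k+1, \] and \[ F^{(k)}_{q,n}=U_{q,n}-\sum_{j=1}^{n-k-1}V_{q,j}F_{q,n-k-j}^{(k)}\quad\text{for all } n\geq k+2. \]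
   Context: For integers $q\geq 1$ and $k\geq 2$, the sequence of $(q,k)$-generalized Fibonacci numbers $(F^{(k)}_{q,n})_{n\geq 2-k}$ is defined by the initial conditions $F^{(k)}_{q,-(k-2)}=F^{(k)}_{q,-(k-3)}=\cdots=F^{(k)}_{q,0}=0$, $F^{(k)}_{q,1}=1$, and the recurrence $F_{q,n}^{(k)}=qF_{q,n-1}^{(k)}+F_{q,n-2}^{(k)}+\cdots+F_{q,n-k}^{(k)}$ for all $n\geq 2$. *)

theory Defs
  imports Main
begin

(* The sequence is indexed by integers n >= 2 - k; the values at smaller indices are junk
   and are never reached by the recurrence, since n - k >= 2 - k for n >= 2. *)
function gfib :: "int \<Rightarrow> nat \<Rightarrow> int \<Rightarrow> int" where
  "gfib q k n =
     (if n \<le> 0 then 0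
      else if n = 1 then 1
      else q * gfib q k (n - 1) + (\<Sum>i = 2..k. gfib q k (n - int i)))"
  by auto
termination
  by (relation "measure (\<lambda>(q, k, n). nat n)") auto

declare gfib.simps [simp del]

lemma gfib_nonpos: "n \<le> 0 \<Longrightarrow> gfib q k n = 0"
  by (simp add: gfib.simps)

lemma gfib_1: "gfib q k 1 = 1"
  by (simp add: gfib.simps)

lemma gfib_rec:
  "2 \<le> n \<Longrightarrow> gfib q k n = q * gfib q k (n - 1) + (\<Sum>i = 2..k. gfib q k (n - int i))"
  by (subst gfib.simps) simp

(* U and V start at index 1; their values at 0 are junk. *)
fun U :: "int \<Rightarrow> nat \<Rightarrow> int" where
  "U q 0 = 0"
| "U q (Suc 0) = 1"
| "U q (Suc (Suc 0)) = q"
| "U q (Suc (Suc (Suc n))) = (q + 1) * U q (Suc (Suc n)) - (q - 1) * U q (Suc n)"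

fun V :: "int \<Rightarrow> nat \<Rightarrow> int" where
  "V q 0 = 0"
| "V q (Suc 0) = 1"
| "V q (Suc (Suc 0)) = q + 1"
| "V q (Suc (Suc (Suc n))) = (q + 1) * V q (Suc (Suc n)) - (q - 1) * V q (Suc n)"

end

theory Submission
  imports Defs
begin

text \<open>Subtracting two consecutive instances of the defining recurrence of F telescopes it to
  \<open>F (n + 2) = (q + 1) F (n + 1) - (q - 1) F n - F (n + 1 - k)\<close>. This is the recurrence of U with
  the inhomogeneity \<open>- F (n + 1 - k)\<close>, and V is the fundamental solution of the homogeneous
  recurrence, so the convolution of V with that inhomogeneity accounts for the difference of F
  and U. Since F vanishes at nonpositive indices, the convolution is zero up to \<open>k + 1\<close>.\<close>

lemma gfib_telescoped:
  assumes "k \<ge> 1" and "n \<ge> 1"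
  shows "gfib q k (n + 2) =
    (q + 1) * gfib q k (n + 1) - (q - 1) * gfib q k n - gfib q k (n + 1 - int k)"
proof -
  have telescope: "(\<Sum>i = 2..k. f (n + 2 - int i)) - (\<Sum>i = 2..k. f (n + 1 - int i)) =
      f n - f (n + 1 - int k)" for f :: "int \<Rightarrow> int"
    using \<open>k \<ge> 1\<close> by (induction k rule: dec_induct) (simp_all add: algebra_simps)
  have "gfib q k (n + 2) = q * gfib q k (n + 1) + (\<Sum>i = 2..k. gfib q k (n + 2 - int i))"
    using gfib_rec[of "n + 2" q k] \<open>n \<ge> 1\<close> by (simp add: algebra_simps)
  \<comment> \<open>The lower instance sits at \<open>n + 1\<close>, which must be at least 2
    because \<open>gfib q k 1\<close> is an initial value; hence \<open>n \<ge> 1\<close>.\<close>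
  moreover have "gfib q k (n + 1) = q * gfib q k n + (\<Sum>i = 2..k. gfib q k (n + 1 - int i))"
    using gfib_rec[of "n + 1" q k] \<open>n \<ge> 1\<close> by simp
  ultimately show ?thesis
    using telescope[of "gfib q k"] by (simp add: algebra_simps)
qed

lemma U_rec: "n \<ge> 1 \<Longrightarrow> U q (n + 2) = (q + 1) * U q (n + 1) - (q - 1) * U q n"
  by (cases n) auto

text \<open>The junk value \<open>V q 0 = 0\<close> is the one that extends the recurrence to \<open>n = 0\<close>.\<close>

lemma V_rec: "V q (n + 2) = (q + 1) * V q (n + 1) - (q - 1) * V q n"
  by (cases n) auto

lemma V_convolution_rec:
  fixes q :: int and g :: "int \<Rightarrow> int" and n :: nat
  defines "W \<equiv> \<lambda>m. \<Sum>j = 1..m. V q j * g (int m - int j)"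
  shows "W (n + 2) = (q + 1) * W (n + 1) - (q - 1) * W n + g (int n + 1)"
proof -
  \<comment> \<open>Indexing by the argument of \<open>g\<close> puts the three convolutions over
    the same values \<open>g (n - m)\<close>, so \<open>V_rec\<close> applies termwise. The term
    \<open>m = 0\<close> of \<open>?S 0\<close> is harmless as \<open>V q 0 = 0\<close>; in
    \<open>W (n + 2)\<close> the term \<open>j = 1\<close> is left over and gives
    \<open>g (n + 1)\<close>.\<close>
  let ?S = "\<lambda>d. \<Sum>m\<le>n. V q (m + d) * g (int n - int m)"
  have W0: "W n = ?S 0"
    by (simp add: W_def atMost_atLeast0 sum.atLeast_Suc_atMost[of 0])
  have W1: "W (n + 1) = ?S 1"
    using sum.shift_bounds_cl_Suc_ivl[of "\<lambda>j. V q j * g (int (n + 1) - int j)" 0 n]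
    by (simp add: W_def atMost_atLeast0)
  have "W (n + 2) = g (int n + 1) + (\<Sum>j = Suc (Suc 0)..Suc (Suc n). V q j * g (int (n + 2) - int j))"
    unfolding W_def by (subst sum.atLeast_Suc_atMost) (simp_all add: algebra_simps)
  also have "\<dots> = g (int n + 1) + ?S 2"
    by (simp only: sum.shift_bounds_cl_Suc_ivl) (simp add: atMost_atLeast0)
  also have "?S 2 = (q + 1) * ?S 1 - (q - 1) * ?S 0"
    by (simp only: V_rec sum_distrib_left sum_subtractf[symmetric] left_diff_distrib mult.assoc add_0_right)
  finally show ?thesis
    using W0 W1 by simp
qed

text \<open>Summing up to \<open>n\<close> instead of \<open>n - k - 1\<close> only adds zero terms;
  it lets one induction cover both ranges of \<open>n\<close>, with \<open>V_convolution_rec\<close>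
  applied to \<open>gfib\<close> shifted by \<open>k\<close>.\<close>

lemma gfib_eq_U_minus_convolution:
  assumes "k \<ge> 1" and "n \<ge> 1"
  shows "gfib q k (int n) = U q n - (\<Sum>j = 1..n. V q j * gfib q k (int n - int j - int k))"
  using \<open>n \<ge> 1\<close>
proof (induction q n rule: U.induct)
  case (2 q)
  then show ?case by (simp add: gfib_nonpos gfib_1)
next
  case (3 q)
  have "gfib q k 2 = q"
    using gfib_rec[of 2 q k] gfib_1[of q k] by (simp add: gfib_nonpos)
  moreover have "{1..Suc (Suc 0)} = {1, 2}" by auto
  ultimately show ?case
    using \<open>k \<ge> 1\<close> by (simp add: gfib_nonpos)
next
  case (4 q m)
  define W where "W = (\<lambda>n. \<Sum>j = 1..n. V q j * gfib q k (int n - int j - int k))"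
  define n where "n = Suc m"
  have "W (n + 2) = (q + 1) * W (n + 1) - (q - 1) * W n + gfib q k (int n + 1 - int k)"
    using V_convolution_rec[of q "\<lambda>i. gfib q k (i - int k)" n] unfolding W_def .
  moreover have "gfib q k (int (n + 2)) = (q + 1) * gfib q k (int (n + 1)) - (q - 1) * gfib q k (int n)
      - gfib q k (int n + 1 - int k)"
    using gfib_telescoped[OF \<open>k \<ge> 1\<close>, of "int n" q] by (simp add: n_def algebra_simps)
  moreover have "U q (n + 2) = (q + 1) * U q (n + 1) - (q - 1) * U q n"
    by (rule U_rec) (simp add: n_def)
  moreover have "gfib q k (int (n + 1)) = U q (n + 1) - W (n + 1)" "gfib q k (int n) = U q n - W n"
    using "4.IH" by (simp_all add: W_def n_def)
  ultimately have "gfib q k (int (n + 2)) = U q (n + 2) - W (n + 2)"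
    by algebra
  then show ?case by (simp only: W_def n_def add_2_eq_Suc')
qed simp

theorem theorem3:
  fixes q :: int and k :: nat
  assumes "k \<ge> 2" and "q \<ge> 3"
  shows "(\<forall>n::nat. 1 \<le> n \<and> n \<le> k + 1 \<longrightarrow> gfib q k (int n) = U q n) \<and>
    (\<forall>n::nat. n \<ge> k + 2 \<longrightarrow>
      gfib q k (int n) =
        U q n - (\<Sum>j = 1..n - k - 1. V q j * gfib q k (int n - int k - int j)))"
proof -
  \<comment> \<open>Terms with \<open>j \<ge> n - k\<close> have a nonpositive \<open>gfib\<close>
    argument. For \<open>n \<le> k + 1\<close> truncated subtraction makes the right-hand sum empty,
    which yields the first claim.\<close>
  have truncate: "(\<Sum>j = 1..n. V q j * gfib q k (int n - int j - int k)) =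
      (\<Sum>j = 1..n - k - 1. V q j * gfib q k (int n - int k - int j))" for n
    by (rule sum.mono_neutral_cong_right) (auto simp: gfib_nonpos algebra_simps)
  have "gfib q k (int n) = U q n - (\<Sum>j = 1..n - k - 1. V q j * gfib q k (int n - int k - int j))"
    if "n \<ge> 1" for n
    using gfib_eq_U_minus_convolution[of k n q] that \<open>k \<ge> 2\<close> by (simp only: truncate)
  then show ?thesis by auto
qed

end
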